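(* Let $s$ be a Sturmian word over $\{0,1\}$ and let $T:\{0,1\}^*\to\{0,1\}^*$ be a marked morphism. Then there exist constants $N$ and $k$ such that the permutation complexity of $T(s)$ satisfies $f_{T(s)}(n)=n+k$ for all $n>N$.
   Context: A Sturmian word is an infinite word having exactly $n+1$ distinct factors of length $n$ for every $n\ge 0$. A binary morphism $T$ is marked if $T(0)$ and $T(1)$ begin with different letters and end with different letters. Infinite words are compared in the lexicographic order induced by $0<1$. For an infinite aperiodic binary word $\omega=\omega_0\omega_1\cdots$, let $\pi_\omega$ be the linear order on $\mathbb{N}$ with $\pi_\omega(i)<\pi_\omega(j)$ iff $\omega[i,\infty]<\omega[j,\infty]$ lexicographically, where $\omega[i,\infty]=\omega_i\omega_{i+1}\cdots$. For $i<j$, $\pi_\omega[i,j]$ is the permutation of $\{1,\dots,j-i+1\}$ with $\pi_\omega[i,j](k)<\pi_\omega[i,j](m)$ iff $\pi_\omega(i+k-1)<\pi_\omega(i+m-1)$; these are the subpermutations of length $j-i+1$. The permutation complexity $f_\omega(n)$ is the number of distinct subpermutations of length $n$ of $\pi_\omega$. *)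

theory Defs
  imports "HOL-Library.Fun_Lexorder" "HOL-Combinatorics.Permutations"
begin

text \<open>
  The alphabet \<open>{0 < 1}\<close> is the type \<^typ>\<open>bool\<close>, with \<open>0 = False\<close> and \<open>1 = True\<close>;
  infinite words are functions on \<^typ>\<open>nat\<close> and finite words are lists.
\<close>

definition suffix_at :: "(nat \<Rightarrow> 'a) \<Rightarrow> nat \<Rightarrow> (nat \<Rightarrow> 'a)" where
  "suffix_at w i = (\<lambda>n. w (i + n))"

definition factors :: "(nat \<Rightarrow> 'a) \<Rightarrow> nat \<Rightarrow> 'a list set" where
  "factors w n = {map w [i..<i + n] | i. True}"

definition sturmian :: "(nat \<Rightarrow> 'a) \<Rightarrow> bool" where
  "sturmian w \<longleftrightarrow> (\<forall>n. finite (factors w n) \<and> card (factors w n) = n + 1)"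

definition morphism :: "('a list \<Rightarrow> 'b list) \<Rightarrow> bool" where
  "morphism T \<longleftrightarrow> (\<forall>u v. T (u @ v) = T u @ T v)"

definition marked :: "(bool list \<Rightarrow> bool list) \<Rightarrow> bool" where
  "marked T \<longleftrightarrow> T [False] \<noteq> [] \<and> T [True] \<noteq> [] \<and>
     hd (T [False]) \<noteq> hd (T [True]) \<and> last (T [False]) \<noteq> last (T [True])"

text \<open>
  The image of an infinite word under a non-erasing morphism: then the image of the prefix of
  length \<open>i + 1\<close> has length greater than \<open>i\<close>, so it determines the letter at position \<open>i\<close>
  (see \<open>morph_image_prefix\<close> below).
\<close>

definition morph_image :: "('a list \<Rightarrow> 'b list) \<Rightarrow> (nat \<Rightarrow> 'a) \<Rightarrow> (nat \<Rightarrow> 'b)" where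
  "morph_image T w i = T (map w [0..<Suc i]) ! i"

text \<open>\<open>perm_less w i j\<close> is \<open>\<pi>\<^sub>w(i) < \<pi>\<^sub>w(j)\<close>.\<close>

definition perm_less :: "(nat \<Rightarrow> 'a::linorder) \<Rightarrow> nat \<Rightarrow> nat \<Rightarrow> bool" where
  "perm_less w i j \<longleftrightarrow> less_fun (suffix_at w i) (suffix_at w j)"

text \<open>
  \<open>\<pi>\<^sub>w[i,j]\<close>, as a permutation of \<open>{1..j - i + 1}\<close> extended by the identity. It exists and is
  unique whenever \<open>w\<close> has no two equal suffixes, i.e. is not eventually periodic
  (see \<open>subperm_ex1\<close> below).
\<close>

definition subperm :: "(nat \<Rightarrow> 'a::linorder) \<Rightarrow> nat \<Rightarrow> nat \<Rightarrow> (nat \<Rightarrow> nat)" where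
  "subperm w i j = (THE p. p permutes {1..j - i + 1} \<and>
     (\<forall>k\<in>{1..j - i + 1}. \<forall>m\<in>{1..j - i + 1}.
        p k < p m \<longleftrightarrow> perm_less w (i + k - 1) (i + m - 1)))"

definition perm_complexity :: "(nat \<Rightarrow> 'a::linorder) \<Rightarrow> nat \<Rightarrow> nat" where
  "perm_complexity w n = card {subperm w i j | i j. i < j \<and> j - i + 1 = n}"

lemma morph_image_prefix:
  assumes T: "morphism T" and ne: "\<And>a. T [a] \<noteq> []"
  shows "T (map w [0..<n]) = map (morph_image T w) [0..<length (T (map w [0..<n]))]"
proof -
  have app: "T (u @ v) = T u @ T v" for u v
    using T by (simp add: morphism_def)
  have Nil: "T [] = []"
    using app[of "[]" "[]"] by simp
  have len: "length xs \<le> length (T xs)" for xs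
  proof (induction xs)
    case (Cons a xs)
    have "T (a # xs) = T [a] @ T xs"
      using app[of "[a]" xs] by simp
    moreover have "length (T [a]) \<ge> 1"
      using ne[of a] by (cases "T [a]") auto
    ultimately show ?case
      using Cons.IH by simp
  qed (simp add: Nil)
  have ext: "T (map w [0..<l]) ! k = T (map w [0..<m]) ! k"
    if "l \<le> m" "k < length (T (map w [0..<l]))" for l m k
  proof -
    have "[0..<m] = [0..<l] @ [l..<m]"
      using that(1) upt_add_eq_append[of 0 l "m - l"] by simp
    then show ?thesis
      using that(2) by (simp add: app nth_append)
  qed
  show ?thesis
  proof (rule nth_equalityI)
    fix k assume k: "k < length (T (map w [0..<n]))"
    have k': "k < length (T (map w [0..<Suc k]))"
      using len[of "map w [0..<Suc k]"] by simp
    have "T (map w [0..<n]) ! k = T (map w [0..<Suc k]) ! k"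
      using ext[of n "Suc k" k] ext[of "Suc k" n k] k k' by (cases "n \<le> Suc k") auto
    then show "T (map w [0..<n]) ! k = map (morph_image T w) [0..<length (T (map w [0..<n]))] ! k"
      using k by (simp add: morph_image_def)
  qed simp
qed

lemma perm_less_irrefl: "\<not> perm_less w i i"
  by (simp add: perm_less_def less_fun_irrefl)

lemma perm_less_trans: "perm_less w i j \<Longrightarrow> perm_less w j k \<Longrightarrow> perm_less w i k"
  unfolding perm_less_def by (rule less_fun_trans)

lemma perm_less_total:
  assumes "suffix_at w i \<noteq> suffix_at w j"
  shows "perm_less w i j \<or> perm_less w j i"
proof -
  let ?P = "\<lambda>k. suffix_at w i k \<noteq> suffix_at w j k"
  have "\<exists>k. ?P k"
    using assms by blast
  then obtain k where k: "?P k" and least: "\<And>k'. k' < k \<Longrightarrow> \<not> ?P k'"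
    using exists_least_iff[of ?P] by blast
  from k have "suffix_at w i k < suffix_at w j k \<or> suffix_at w j k < suffix_at w i k"
    by (rule neq_iff[THEN iffD1])
  then show ?thesis
    unfolding perm_less_def less_fun_def using least by auto
qed

lemma subperm_ex1:
  fixes w :: "nat \<Rightarrow> 'a::linorder"
  assumes inj: "inj (suffix_at w)"
  shows "\<exists>!p. p permutes {1..n} \<and>
     (\<forall>k\<in>{1..n}. \<forall>m\<in>{1..n}. p k < p m \<longleftrightarrow> perm_less w (i + k - 1) (i + m - 1))"
proof -
  let ?A = "{1..n}"
  define L where "L k m \<longleftrightarrow> perm_less w (i + k - 1) (i + m - 1)" for k m
  have irrefl: "\<not> L k k" for k
    by (simp add: L_def perm_less_irrefl)
  have trans: "L k m \<Longrightarrow> L m l \<Longrightarrow> L k l" for k m l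
    unfolding L_def by (rule perm_less_trans)
  have total: "L k m \<or> L m k" if "k \<in> ?A" "m \<in> ?A" "k \<noteq> m" for k m
  proof -
    have "i + k - 1 \<noteq> i + m - 1"
      using that by auto
    then show ?thesis
      unfolding L_def using inj by (intro perm_less_total) (auto dest: injD)
  qed
  define r where "r k = card {m \<in> ?A. m = k \<or> L m k}" for k
  have mono: "r k < r m" if "k \<in> ?A" "m \<in> ?A" "L k m" for k m
    unfolding r_def
  proof (rule psubset_card_mono)
    have "{x \<in> ?A. x = k \<or> L x k} \<subseteq> {x \<in> ?A. x = m \<or> L x m}"
      using that trans by blast
    moreover have "m \<notin> {x \<in> ?A. x = k \<or> L x k}"
      using that trans irrefl by blast
    ultimately show "{x \<in> ?A. x = k \<or> L x k} \<subset> {x \<in> ?A. x = m \<or> L x m}"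
      using that by blast
  qed simp
  have iff: "r k < r m \<longleftrightarrow> L k m" if "k \<in> ?A" "m \<in> ?A" for k m
    using mono[OF that] mono[OF that(2,1)] total[OF that] by (metis less_asym less_irrefl)
  have inj_r: "inj_on r ?A"
    by (rule inj_onI) (metis iff total less_irrefl)
  have "r ` ?A \<subseteq> ?A"
  proof (rule image_subsetI)
    fix k assume k: "k \<in> ?A"
    have "card {k} \<le> r k"
      unfolding r_def using k by (intro card_mono) auto
    moreover have "r k \<le> card ?A"
      unfolding r_def by (intro card_mono) auto
    ultimately show "r k \<in> ?A"
      by simp
  qed
  then have bij: "bij_betw r ?A ?A"
    using inj_r by (simp add: bij_betw_def endo_inj_surj)
  have rank: "q k = card {m \<in> ?A. m = k \<or> L m k}"
    if q: "q permutes ?A" and qL: "\<forall>k\<in>?A. \<forall>m\<in>?A. q k < q m \<longleftrightarrow> L k m" and k: "k \<in> ?A" for q k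
  proof -
    have qk: "q k \<in> ?A"
      using permutes_in_image[OF q] k by blast
    have eq: "{m \<in> ?A. m = k \<or> L m k} = {m \<in> ?A. q m \<le> q k}"
      using qL k permutes_inj[OF q] by (auto simp: le_less dest: injD)
    have "q ` {m \<in> ?A. q m \<le> q k} = {1..q k}"
    proof
      show "q ` {m \<in> ?A. q m \<le> q k} \<subseteq> {1..q k}"
      proof (rule image_subsetI)
        fix m assume m: "m \<in> {m \<in> ?A. q m \<le> q k}"
        then have "q m \<in> ?A"
          by (simp only: permutes_in_image[OF q] mem_Collect_eq)
        with m show "q m \<in> {1..q k}"
          by simp
      qed
      show "{1..q k} \<subseteq> q ` {m \<in> ?A. q m \<le> q k}"
      proof
        fix x assume x: "x \<in> {1..q k}"
        then have "x \<in> q ` ?A"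
          using qk permutes_image[OF q] by auto
        then show "x \<in> q ` {m \<in> ?A. q m \<le> q k}"
          using x by auto
      qed
    qed
    then have "card {m \<in> ?A. q m \<le> q k} = q k"
      using card_image[of q "{m \<in> ?A. q m \<le> q k}"] permutes_inj_on[OF q] by simp
    then show ?thesis
      by (simp only: eq)
  qed
  let ?p = "\<lambda>k. if k \<in> ?A then r k else k"
  have "?p permutes ?A"
  proof (rule bij_imp_permutes)
    show "bij_betw ?p ?A ?A"
      using bij by (rule iffD1[OF bij_betw_cong, rotated]) simp
  qed auto
  moreover have "\<forall>k\<in>?A. \<forall>m\<in>?A. ?p k < ?p m \<longleftrightarrow> L k m"
    using iff by auto
  moreover have "q = q'"
    if "q permutes ?A" "\<forall>k\<in>?A. \<forall>m\<in>?A. q k < q m \<longleftrightarrow> L k m"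
       "q' permutes ?A" "\<forall>k\<in>?A. \<forall>m\<in>?A. q' k < q' m \<longleftrightarrow> L k m" for q q'
  proof
    fix k show "q k = q' k"
      using rank[OF that(1,2)] rank[OF that(3,4)] permutes_not_in[OF that(1)] permutes_not_in[OF that(3)]
      by (cases "k \<in> ?A") auto
  qed
  ultimately show ?thesis
    unfolding L_def[symmetric] by blast
qed

end

theory Submission
  imports Defs "HOL-Library.Infinite_Set"
begin

text \<open>
  Let \<open>w = T(s)\<close> and let \<open>f\<close> be its permutation complexity. Since \<open>w\<close> is aperiodic, \<open>f\<close> is strictly
  increasing: if subpermutations of some length determined those of the next length, two suffixes of
  \<open>w\<close> would coincide. Hence \<open>f(n) - n\<close> is nondecreasing, and it suffices to bound it.

  Label each position of \<open>w\<close> by the letter of \<open>s\<close> whose image covers it and by the offset inside that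
  image. The word of labels has at most one right special factor of each length, because \<open>s\<close> does, so
  it has at most \<open>n + C\<close> factors of length \<open>n\<close>. A subpermutation of length \<open>n\<close> is determined by the
  label factor of length \<open>n + L\<close>: suffixes of \<open>w\<close> with different labels differ within \<open>L\<close> letters,
  and two suffixes with the same label compare as the corresponding suffixes of \<open>s\<close> (or in reverse).
  Finally, in the balanced word \<open>s\<close> the order of the suffixes at \<open>i\<close> and \<open>i + d\<close> depends only on the
  factor of length \<open>d\<close> at \<open>i\<close>.
\<close>

section \<open>Sturmian words are balanced\<close>

definition window :: "(nat \<Rightarrow> 'a) \<Rightarrow> nat \<Rightarrow> nat \<Rightarrow> 'a list" where
  "window w n i = map w [i..<i + n]"

text \<open>A property of the factor at \<open>i\<close> alone: any two occurrences of that factor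
  agree on it.\<close>

definition right_special :: "(nat \<Rightarrow> 'a) \<Rightarrow> nat \<Rightarrow> nat \<Rightarrow> bool" where
  "right_special w n i \<longleftrightarrow> (\<exists>j. window w n j = window w n i \<and> w (j + n) \<noteq> w (i + n))"

lemma window_eq_iff: "window w n i = window v n j \<longleftrightarrow> (\<forall>t<n. w (i + t) = v (j + t))"
  by (auto simp: window_def list_eq_iff_nth_eq)

lemma window_Suc: "window w (Suc n) i = window w n i @ [w (i + n)]"
  by (simp add: window_def)

lemma window_Suc_left: "window w (Suc n) i = w i # window w n (Suc i)"
  by (simp add: window_def upt_conv_Cons del: upt_Suc)

lemma factors_eq_range: "factors w n = range (window w n)"
  by (auto simp: factors_def window_def)

lemma suffix_at_eq_iff: "suffix_at w i = suffix_at w j \<longleftrightarrow> (\<forall>t. w (i + t) = w (j + t))"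
  by (auto simp: suffix_at_def fun_eq_iff)

lemma inj_suffix_atI:
  assumes "\<And>i d. 0 < d \<Longrightarrow> \<exists>t. w (i + t) \<noteq> w (i + d + t)"
  shows "inj (suffix_at w)"
proof (rule injI)
  fix i j assume eq: "suffix_at w i = suffix_at w j"
  show "i = j"
  proof (rule ccontr)
    assume "i \<noteq> j"
    then consider "i < j" | "j < i" by linarith
    then show False
      using assms[of "j - i" i] assms[of "i - j" j] eq
      by cases (auto simp: suffix_at_eq_iff)
  qed
qed

lemma perm_less_iff:
  fixes w :: "nat \<Rightarrow> 'a::linorder"
  assumes "\<And>t. t < k \<Longrightarrow> w (i + t) = w (j + t)" and "w (i + k) \<noteq> w (j + k)"
  shows "perm_less w i j \<longleftrightarrow> w (i + k) < w (j + k)"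
proof
  assume "w (i + k) < w (j + k)"
  then show "perm_less w i j"
    using assms(1) by (auto simp: perm_less_def less_fun_def suffix_at_def)
next
  assume "perm_less w i j"
  then obtain l where l: "w (i + l) < w (j + l)" "\<And>t. t < l \<Longrightarrow> w (i + t) = w (j + t)"
    by (auto simp: perm_less_def less_fun_def suffix_at_def)
  have "l = k"
    using l assms by (metis less_irrefl linorder_neqE_nat)
  with l show "w (i + k) < w (j + k)" by simp
qed

lemma first_difference:
  assumes "suffix_at w i \<noteq> suffix_at w j"
  obtains k where "\<And>t. t < k \<Longrightarrow> w (i + t) = w (j + t)" and "w (i + k) \<noteq> w (j + k)"
  using assms exists_least_iff[of "\<lambda>k. w (i + k) \<noteq> w (j + k)"]
  by (auto simp: suffix_at_eq_iff)

text \<open>If the suffixes at \<open>i\<close> and \<open>i + d\<close> coincided, shifting back by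
  \<open>d\<close> would bring every factor to a start below \<open>i + d\<close>, leaving at most
  \<open>i + d\<close> factors of length \<open>i + d\<close>, one too few.\<close>

lemma sturmian_inj_suffix_at:
  assumes "sturmian w"
  shows "inj (suffix_at w)"
proof (rule inj_suffix_atI, rule ccontr)
  fix i d :: nat
  assume d: "0 < d" and "\<not> (\<exists>t. w (i + t) \<noteq> w (i + d + t))"
  then have eq: "w (i + t) = w (i + d + t)" for t by blast
  have "window w n k \<in> window w n ` {..<i + d}" for n k
  proof (induction k rule: less_induct)
    case (less k)
    show ?case
    proof (cases "k < i + d")
      case False
      have "window w n k = window w n (k - d)"
        unfolding window_eq_iff
      proof (intro allI impI)
        fix t
        show "w (k + t) = w (k - d + t)"
          using eq[of "k - d - i + t"] False by simp
      qed
      then show ?thesis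
        using less[of "k - d"] d False by simp
    qed blast
  qed
  then have "factors w (i + d) \<subseteq> window w (i + d) ` {..<i + d}"
    by (auto simp: factors_eq_range)
  then have "card (factors w (i + d)) \<le> i + d"
    using card_image_le[of "{..<i + d}" "window w (i + d)"] card_mono
    by (metis (no_types, lifting) card_lessThan finite_imageI finite_lessThan le_trans)
  then show False
    using assms by (simp add: sturmian_def)
qed

text \<open>There is only one more factor of length \<open>n + 1\<close> than of length
  \<open>n\<close>. With two right special factors, deleting one extension of each would leave
  \<open>n\<close> words still projecting onto all \<open>n + 1\<close> factors of length
  \<open>n\<close>.\<close>

lemma sturmian_right_special_unique:
  assumes st: "sturmian w" and i: "right_special w n i" and j: "right_special w n j"
  shows "window w n i = window w n j"
proof (rule ccontr)
  assume ne: "window w n i \<noteq> window w n j"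
  obtain i' where i': "window w n i' = window w n i" "w (i' + n) \<noteq> w (i + n)"
    using i by (auto simp: right_special_def)
  obtain j' where j': "window w n j' = window w n j" "w (j' + n) \<noteq> w (j + n)"
    using j by (auto simp: right_special_def)
  let ?u = "window w (Suc n) i" and ?v = "window w (Suc n) j"
  have fin: "finite (factors w n)" "finite (factors w (Suc n))"
    and card: "card (factors w n) = n + 1" "card (factors w (Suc n)) = n + 2"
    using st by (auto simp: sturmian_def)
  have "factors w n \<subseteq> butlast ` (factors w (Suc n) - {?u, ?v})"
  proof
    fix x assume "x \<in> factors w n"
    then obtain k where k: "x = window w n k" by (auto simp: factors_eq_range)
    define l where "l = (if window w (Suc n) k = ?u then i' else if window w (Suc n) k = ?v then j' else k)"
    have "window w (Suc n) l \<noteq> ?u" "window w (Suc n) l \<noteq> ?v" "window w n l = x"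
      using i' j' ne k by (auto simp: l_def window_Suc)
    then show "x \<in> butlast ` (factors w (Suc n) - {?u, ?v})"
      by (intro image_eqI[of _ _ "window w (Suc n) l"]) (auto simp: factors_eq_range window_Suc)
  qed
  then have "card (factors w n) \<le> card (factors w (Suc n) - {?u, ?v})"
    using fin by (meson card_image_le card_mono finite_Diff finite_imageI le_trans)
  also have "\<dots> = card (factors w (Suc n)) - card {?u, ?v}"
    using fin by (intro card_Diff_subset) (auto simp: factors_eq_range)
  also have "card {?u, ?v} = 2"
    using ne by (simp add: window_Suc)
  finally show False using card by simp
qed

section \<open>Counting ones in windows\<close>

definition ones :: "(nat \<Rightarrow> bool) \<Rightarrow> nat \<Rightarrow> nat \<Rightarrow> int" where
  "ones w n i = (\<Sum>t<n. of_bool (w (i + t)))"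

definition balanced :: "(nat \<Rightarrow> bool) \<Rightarrow> bool" where
  "balanced w \<longleftrightarrow> (\<forall>n i j. ones w n i \<le> ones w n j + 1)"

lemma ones_0 [simp]: "ones w 0 i = 0"
  by (simp add: ones_def)

lemma ones_Suc: "ones w (Suc n) i = ones w n i + of_bool (w (i + n))"
  by (simp add: ones_def)

lemma ones_add: "ones w (m + n) i = ones w m i + ones w n (i + m)"
  by (induction n) (simp_all add: ones_Suc add.assoc)

lemma ones_Suc_left: "ones w (Suc n) i = of_bool (w i) + ones w n (Suc i)"
  using ones_add[of w 1 n i] by (simp add: ones_Suc)

text \<open>Both sides count the ones of the window of length \<open>d + n\<close> at
  \<open>i\<close>, cut in two ways.\<close>

lemma ones_shift: "ones w d (i + n) + ones w n i = ones w d i + ones w n (i + d)"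
  using ones_add[of w n d i] ones_add[of w d n i] by (simp add: add.commute)

lemma ones_cong: "(\<And>t. t < n \<Longrightarrow> w (i + t) = w (j + t)) \<Longrightarrow> ones w n i = ones w n j"
  by (simp add: ones_def)

lemma ones_bounds: "0 \<le> ones w n i" "ones w n i \<le> int n"
  by (induction n) (auto simp: ones_Suc)

text \<open>Compare two windows of minimal length whose counts differ by at least 2: minimality
  forces them to be \<open>1u1\<close> and \<open>0u0\<close> with the same palindrome
  \<open>u\<close> of length \<open>n\<close>.\<close>

lemma unbalanced_palindrome:
  assumes "\<not> balanced w"
  obtains n i j where "w i" "w (i + Suc n)" "\<not> w j" "\<not> w (j + Suc n)"
    and "\<And>t. t < n \<Longrightarrow> w (i + Suc t) = w (j + Suc t)"
    and "\<And>t. t < n \<Longrightarrow> w (i + Suc t) = w (i + n - t)"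
proof -
  let ?U = "\<lambda>N. \<exists>i j. ones w N i \<ge> ones w N j + 2"
  have "\<exists>N. ?U N"
    using assms unfolding balanced_def by (metis add.assoc not_le one_add_one zless_add1_eq zless_imp_add1_zle)
  then obtain N where "?U N" and min: "\<And>M. M < N \<Longrightarrow> \<not> ?U M"
    using exists_least_iff[of ?U] by blast
  then obtain i j where ij: "ones w N i \<ge> ones w N j + 2" by blast
  have min': "ones w M k \<le> ones w M l + 1" if "M < N" for M k l
    using min[OF that] by (metis add.assoc not_le one_add_one zless_imp_add1_zle)
  \<comment> \<open>The remaining parts of length \<open>N - M\<close> are shorter than
    \<open>N\<close>, so they account for a difference of at most 1.\<close>
  have pre: "ones w M i \<ge> ones w M j + 1" if "0 < M" "M \<le> N" for M
    using ij ones_add[of w M "N - M" i] ones_add[of w M "N - M" j] min'[of "N - M" "i + M" "j + M"] that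
    by simp
  have N2: "N \<ge> 2"
    using ij ones_bounds[of w N i] ones_bounds[of w N j] by linarith
  define n where "n = N - 2"
  have N: "N = Suc (Suc n)" using N2 by (simp add: n_def)
  have first: "w i" "\<not> w j"
    using pre[of 1] N by (auto simp: ones_Suc of_bool_def split: if_splits)
  have mid: "ones w M i = ones w M j + 1" if "0 < M" "M < N" for M
    using pre[of M] min'[of M i j] that by linarith
  have eq: "w (i + Suc t) = w (j + Suc t)" if "t < n" for t
    using mid[of "Suc t"] mid[of "Suc (Suc t)"] that N by (auto simp: ones_Suc of_bool_def split: if_splits)
  have last: "w (i + Suc n)" "\<not> w (j + Suc n)"
    using mid[of "Suc n"] ij N by (auto simp: ones_Suc of_bool_def split: if_splits)
  \<comment> \<open>If the outer letters of \<open>u\<close> match but those at \<open>t\<close> do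
    not, a prefix of \<open>1u1\<close> and a suffix of \<open>0u0\<close> of length
    \<open>t + 2\<close>, or a suffix of \<open>1u1\<close> and a prefix of \<open>0u0\<close>, have
    counts differing by 2, although \<open>t + 2 < N\<close>.\<close>
  have pal: "w (i + Suc t) = w (i + n - t)" if "t < n" for t
    using that
  proof (induction t rule: less_induct)
    case (less t)
    have inner: "ones w t (i + Suc 0) = ones w t (j + (Suc n - t))"
    proof -
      have "ones w t (i + Suc 0) = (\<Sum>r<t. of_bool (w (i + n - r)))"
        unfolding ones_def using less by (intro sum.cong) auto
      also have "\<dots> = (\<Sum>r<t. of_bool (w (j + (Suc n - t) + r)))"
      proof (subst sum.nat_diff_reindex[symmetric], intro sum.cong refl)
        fix r assume r: "r \<in> {..<t}"
        then have "w (i + Suc (n - t + r)) = w (j + Suc (n - t + r))"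
          by (intro eq) (use r less.prems in auto)
        then show "of_bool (w (i + n - (t - Suc r))) = (of_bool (w (j + (Suc n - t) + r)) :: int)"
          using r less.prems by (simp add: Suc_diff_le add.commute add.left_commute)
      qed
      finally show ?thesis by (simp add: ones_def)
    qed
    have inner': "ones w t (j + Suc 0) = ones w t (i + (Suc n - t))"
    proof -
      have "ones w t (j + Suc 0) = ones w t (i + Suc 0)"
        using eq less.prems by (intro ones_cong) simp
      moreover have "ones w t (j + (Suc n - t)) = ones w t (i + (Suc n - t))"
      proof (intro ones_cong)
        fix r assume "r < t"
        then have "n - t + r < n" "Suc n - t + r = Suc (n - t + r)"
          using less.prems by auto
        then show "w (j + (Suc n - t) + r) = w (i + (Suc n - t) + r)"
          using eq[of "n - t + r"] by (simp only: add.assoc)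
      qed
      ultimately show ?thesis using inner by simp
    qed
    have ones2: "ones w (Suc (Suc t)) k = of_bool (w k) + ones w t (k + Suc 0) + of_bool (w (k + Suc t))" for k
      using ones_Suc_left[of w "Suc t" k] ones_Suc[of w t "Suc k"] by simp
    have ends: "i + (n - t) + Suc 0 = i + (Suc n - t)" "j + (n - t) + Suc 0 = j + (Suc n - t)"
      "i + (n - t) + Suc t = i + Suc n" "j + (n - t) + Suc t = j + Suc n"
      using less.prems by auto
    have "w (i + (n - t)) = w (j + (n - t))"
      using eq[of "n - Suc t"] less.prems by (simp only: Suc_diff_Suc)
    then show ?case
      using min'[of "Suc (Suc t)" i "j + (n - t)"] min'[of "Suc (Suc t)" "i + (n - t)" j]
        less.prems N first last inner inner' eq[OF less.prems] ends
      by (auto simp: ones2 of_bool_def split: if_splits)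
  qed
  show thesis
    by (rule that[of i n j]) (use first last eq pal in auto)
qed

text \<open>Only \<open>n + 1\<close> factors of length \<open>n + 1\<close> exist besides the right
  special one, so \<open>n + 2\<close> consecutive windows avoiding it repeat. A window that is not
  right special determines the next one, so the word cycles from there on, against
  aperiodicity.\<close>

lemma sturmian_right_special_recurs:
  assumes st: "sturmian w"
    and non: "\<And>k. k \<le> Suc n \<Longrightarrow> \<not> right_special w (Suc n) (i + k)"
    and rs: "right_special w (Suc n) j"
  shows False
proof -
  let ?W = "window w (Suc n)"
  have next_eq: "?W (Suc k) = ?W (Suc l)" if "?W k = ?W l" "\<not> right_special w (Suc n) l" for k l
  proof -
    have "w (k + Suc n) = w (l + Suc n)"
      using that unfolding right_special_def by blast
    then have "window w (Suc (Suc n)) k = window w (Suc (Suc n)) l"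
      using that(1) by (simp only: window_Suc)
    then show ?thesis
      by (simp only: window_Suc_left list.inject)
  qed
  have rs_cong: "right_special w (Suc n) k \<longleftrightarrow> right_special w (Suc n) l" if "?W k = ?W l" for k l
    using that unfolding right_special_def by metis
  have "(\<lambda>k. ?W (i + k)) ` {..Suc n} \<subseteq> factors w (Suc n) - {?W j}"
  proof (rule image_subsetI)
    fix k assume "k \<in> {..Suc n}"
    then have "\<not> right_special w (Suc n) (i + k)" using non by simp
    then have "?W (i + k) \<noteq> ?W j" using rs rs_cong by blast
    then show "?W (i + k) \<in> factors w (Suc n) - {?W j}" by (simp add: factors_eq_range)
  qed
  moreover have "card (factors w (Suc n) - {?W j}) = Suc n" "finite (factors w (Suc n) - {?W j})"
    using st by (auto simp: sturmian_def factors_eq_range)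
  ultimately have "card ((\<lambda>k. ?W (i + k)) ` {..Suc n}) \<le> Suc n"
    by (metis card_mono)
  then have "\<not> inj_on (\<lambda>k. ?W (i + k)) {..Suc n}"
    by (intro pigeonhole) simp
  then obtain a b where ab: "a < b" "b \<le> Suc n" "?W (i + a) = ?W (i + b)"
    unfolding inj_on_def by (metis atMost_iff linorder_neqE_nat)
  have non': "\<exists>r. a \<le> r \<and> r < b \<and> ?W (i + a + t) = ?W (i + r)" for t
  proof (induction t)
    case (Suc t)
    then obtain r where r: "a \<le> r" "r < b" "?W (i + a + t) = ?W (i + r)" by blast
    then have "?W (i + a + Suc t) = ?W (i + Suc r)"
      using next_eq[of "i + a + t" "i + r"] non[of r] ab by simp
    then show ?case
      using r ab by (cases "Suc r = b") (auto intro: exI[of _ a] exI[of _ "Suc r"])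
  qed (use ab in auto)
  have "?W (i + a + t) = ?W (i + b + t)" for t
  proof (induction t)
    case (Suc t)
    have "\<not> right_special w (Suc n) (i + a + t)"
      using non'[of t] non ab rs_cong by (metis less_imp_le_nat order.trans)
    then show ?case
      using next_eq[of "i + b + t" "i + a + t"] Suc by simp
  qed (use ab in auto)
  then have "suffix_at w (i + a) = suffix_at w (i + b)"
    unfolding suffix_at_eq_iff window_eq_iff by (metis add.right_neutral zero_less_Suc)
  then show False
    using sturmian_inj_suffix_at[OF st] ab by (auto dest: injD)
qed

lemma sturmian_balanced:
  assumes st: "sturmian w"
  shows "balanced w"
proof (rule ccontr)
  assume "\<not> balanced w"
  then obtain n i j where ij: "w i" "w (i + Suc n)" "\<not> w j" "\<not> w (j + Suc n)"
    and eq: "\<And>t. t < n \<Longrightarrow> w (i + Suc t) = w (j + Suc t)"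
    and pal: "\<And>t. t < n \<Longrightarrow> w (i + Suc t) = w (i + n - t)"
    by (rule unbalanced_palindrome) blast
  let ?W = "window w (Suc n)"
  have core: "window w n (Suc j) = window w n (Suc i)"
    using eq by (auto simp: window_eq_iff)
  have rs_core: "right_special w n (Suc i)"
    unfolding right_special_def using core ij by (intro exI[of _ "Suc j"]) simp
  \<comment> \<open>Dropping the first letter keeps a factor right special, and the right special
    factor of length \<open>n\<close> is unique: it is the common core of \<open>1u1\<close> and
    \<open>0u0\<close>.\<close>
  have rs_tail: "window w n (Suc k) = window w n (Suc i)" if "right_special w (Suc n) k" for k
  proof -
    obtain l where l: "?W l = ?W k" "w (l + Suc n) \<noteq> w (k + Suc n)"
      using \<open>right_special w (Suc n) k\<close> by (auto simp: right_special_def)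
    then have "right_special w n (Suc k)"
      unfolding right_special_def window_eq_iff
      by (intro exI[of _ "Suc l"]) (metis Suc_mono add_Suc_shift)
    then show ?thesis
      using sturmian_right_special_unique[OF st] rs_core by blast
  qed
  have ne: "?W i \<noteq> ?W j"
    unfolding window_eq_iff using ij(1,3) by (metis add.right_neutral zero_less_Suc)
  \<comment> \<open>Write \<open>u\<close> for the palindrome. At most one of \<open>0u\<close>, \<open>1u\<close> is right special; say \<open>cu\<close> is not. Then
    \<open>cu\<close> is followed by \<open>c\<close>, and by the palindromicity of \<open>u\<close> no other extension of \<open>u\<close> starts
    inside the occurrence \<open>cuc\<close>, so a window free of right special factors arises.\<close>
  have key: False
    if k: "w (k + Suc n) = w k" "window w n (Suc k) = window w n (Suc i)"
      and non: "\<not> right_special w (Suc n) k" for k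
  proof -
    have palk: "w (k + Suc t) = w (k + n - t)" if "t < n" for t
    proof -
      have core': "w (Suc k + r) = w (Suc i + r)" if "r < n" for r
        using k(2) that by (auto simp: window_eq_iff)
      show ?thesis
        using core'[of t] core'[of "n - Suc t"] pal[OF that] that by (simp add: Suc_diff_Suc)
    qed
    have "\<not> right_special w (Suc n) (k + r)" if r: "r \<le> Suc n" for r
    proof
      assume rs: "right_special w (Suc n) (k + r)"
      have tail: "w (Suc (k + r) + t) = w (Suc k + t)" if "t < n" for t
        using rs_tail[OF rs] k(2) that unfolding window_eq_iff by simp
      have "w (k + r) \<noteq> w k"
      proof
        assume "w (k + r) = w k"
        then have "?W (k + r) = ?W k"
          using tail unfolding window_eq_iff by (metis add.right_neutral add_Suc_shift less_Suc_eq_0_disj)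
        then show False
          using rs non by (metis right_special_def)
      qed
      then have "0 < r" "r < Suc n"
        using k(1) r by (auto intro: gr0I simp: le_less)
      then have rn: "r \<le> n" "n - r < n" by auto
      \<comment> \<open>The closing letter \<open>c\<close> is read inside the later copy of
        \<open>u\<close>, moved to the copy at \<open>Suc k\<close> and reflected there; it lands on
        position \<open>k + r\<close>.\<close>
      have "w (k + Suc n) = w (Suc (k + r) + (n - r))"
        using rn by simp
      also have "\<dots> = w (Suc k + (n - r))"
        by (rule tail[OF rn(2)])
      also have "\<dots> = w (k + r)"
        using palk[OF rn(2)] rn by simp
      finally show False
        using k(1) \<open>w (k + r) \<noteq> w k\<close> by simp
    qed
    \<comment> \<open>Without a right special factor, \<open>butlast\<close> would be injective on
      the factors of length \<open>n + 2\<close>, and the number of factors would not grow.\<close>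
    moreover obtain l where "right_special w (Suc n) l"
    proof (atomize_elim, rule ccontr)
      assume none: "\<nexists>l. right_special w (Suc n) l"
      have "inj_on butlast (factors w (Suc (Suc n)))"
      proof (rule inj_onI)
        fix x y assume "x \<in> factors w (Suc (Suc n))" "y \<in> factors w (Suc (Suc n))"
          and eq: "butlast x = butlast y"
        then obtain a b where ab: "x = ?W a @ [w (a + Suc n)]" "y = ?W b @ [w (b + Suc n)]"
          unfolding factors_eq_range window_Suc[of _ "Suc n"] by blast
        then have "?W a = ?W b" using eq by (simp only: butlast_snoc)
        moreover have "w (a + Suc n) = w (b + Suc n)"
          using none calculation unfolding right_special_def by blast
        ultimately show "x = y" using ab by (simp only:)
      qed
      moreover have "butlast ` factors w (Suc (Suc n)) \<subseteq> factors w (Suc n)"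
        by (auto simp: factors_eq_range window_Suc[of _ "Suc n"])
      ultimately have "card (factors w (Suc (Suc n))) \<le> card (factors w (Suc n))"
        using st by (intro card_inj_on_le) (auto simp: sturmian_def)
      then show False using st by (simp add: sturmian_def)
    qed
    ultimately show False
      using sturmian_right_special_recurs[OF st, of n k] by blast
  qed
  show False
    using key[of i] key[of j] core ij sturmian_right_special_unique[OF st, of "Suc n" i j] ne by auto
qed


section \<open>Order and periodicity in balanced words\<close>

text \<open>
  At the first difference of the suffixes at \<open>i\<close> and \<open>i + d\<close>, the number of ones in windows of length \<open>d\<close>
  changes by one, up or down according to the order. Opposite orders from the same count would thus
  give three values of the count, against balance.
\<close>

lemma balanced_perm_less_cong:
  assumes bal: "balanced w" and inj: "inj (suffix_at w)"
    and eq: "\<And>t. t < d \<Longrightarrow> w (i + t) = w (j + t)"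
  shows "perm_less w i (i + d) \<longleftrightarrow> perm_less w j (j + d)"
proof (cases "d = 0")
  case False
  have step: "ones w d (i + Suc k) = ones w d i + (if perm_less w i (i + d) then 1 else - 1)"
    if k: "\<And>t. t < k \<Longrightarrow> w (i + t) = w (i + d + t)" "w (i + k) \<noteq> w (i + d + k)" for i k
  proof -
    have "ones w k i = ones w k (i + d)"
      using k(1) by (rule ones_cong)
    then show ?thesis
      using ones_shift[of w d i "Suc k"] perm_less_iff[OF k] k(2)
      by (auto simp: ones_Suc of_bool_def split: if_splits)
  qed
  have ex: "\<exists>k. ones w d (i + Suc k) = ones w d i + (if perm_less w i (i + d) then 1 else - 1)" for i
  proof -
    have "suffix_at w i \<noteq> suffix_at w (i + d)"
      using False inj by (auto dest: injD)
    then obtain k where "\<And>t. t < k \<Longrightarrow> w (i + t) = w (i + d + t)" "w (i + k) \<noteq> w (i + d + k)"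
      by (rule first_difference) blast
    then show ?thesis using step by blast
  qed
  obtain k l where k: "ones w d (i + Suc k) = ones w d i + (if perm_less w i (i + d) then 1 else - 1)"
    and l: "ones w d (j + Suc l) = ones w d j + (if perm_less w j (j + d) then 1 else - 1)"
    using ex by meson
  moreover have "ones w d i = ones w d j"
    using eq by (rule ones_cong)
  moreover have "ones w d (i + Suc k) \<le> ones w d (j + Suc l) + 1" "ones w d (j + Suc l) \<le> ones w d (i + Suc k) + 1"
    using bal unfolding balanced_def by blast+
  ultimately show ?thesis by (auto split: if_splits)
qed (simp add: perm_less_irrefl)

lemma ones_mult: "ones w (k * d) i = (\<Sum>r<k. ones w d (i + r * d))"
  by (induction k) (simp_all add: ones_add add.commute[of d])

text \<open>Long runs of period \<open>d\<close> contain the same number \<open>c\<close> of ones in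
  each block of length \<open>d\<close>. Balance then keeps every window of length
  \<open>k * d\<close> within 1 of \<open>k * c\<close>, so other counts are too rare and the word
  would be eventually periodic.\<close>

lemma balanced_aperiodic_bounded_period:
  assumes bal: "balanced w" and inj: "inj (suffix_at w)" and d: "0 < d"
  shows "\<exists>K. \<forall>i. \<exists>t<K. w (i + t) \<noteq> w (i + d + t)"
proof (rule ccontr)
  assume "\<not> ?thesis"
  then have per: "\<exists>i. \<forall>t<K. w (i + t) = w (i + d + t)" for K by blast
  \<comment> \<open>Asking for all \<open>l \<le> k\<close> makes \<open>?Q c\<close> antitone in
    \<open>k\<close>; hence a maximum over the finitely many \<open>c \<le> d\<close> yields one
    \<open>c\<close> that works for every \<open>k\<close>.\<close>
  let ?Q = "\<lambda>c k. \<exists>i. \<forall>l\<le>k. ones w (l * d) i = int l * int c"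
  have Q: "\<exists>c\<le>d. ?Q c k" for k
  proof -
    obtain i where i: "\<And>t. t < k * d \<Longrightarrow> w (i + t) = w (i + d + t)"
      using per by blast
    have const: "ones w d (i + r) = ones w d i" if "r \<le> k * d" for r
      using ones_shift[of w d i r] ones_cong[of r w i "i + d"] i that by simp
    have "ones w (l * d) i = int l * int (nat (ones w d i))" if "l \<le> k" for l
    proof -
      have "ones w (l * d) i = (\<Sum>r<l. ones w d i)"
        unfolding ones_mult using that by (intro sum.cong refl const) (simp add: mult_le_mono1)
      then show ?thesis using ones_bounds[of w d i] by simp
    qed
    then show ?thesis
      using ones_bounds[of w d i] by (intro exI[of _ "nat (ones w d i)"]) auto
  qed
  obtain c where c: "\<And>k. ?Q c k"
  proof (atomize_elim, rule ccontr)
    assume "\<nexists>c. \<forall>k. ?Q c k"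
    then obtain K where K: "\<And>c. \<not> ?Q c (K c)" by metis
    obtain c where "c \<le> d" "?Q c (Max (K ` {..d}))" using Q by blast
    moreover have "K c \<le> Max (K ` {..d})" using \<open>c \<le> d\<close> by simp
    ultimately show False using K[of c] by (meson le_trans)
  qed
  have near: "\<bar>ones w (k * d) i - int k * int c\<bar> \<le> 1" for k i
  proof -
    obtain j where "ones w (k * d) j = int k * int c" using c[of k] by blast
    moreover have "ones w (k * d) j \<le> ones w (k * d) i + 1" "ones w (k * d) i \<le> ones w (k * d) j + 1"
      using bal unfolding balanced_def by blast+
    ultimately show ?thesis by linarith
  qed
  \<comment> \<open>\<open>\<sigma>\<close> is the common sign of all deviations from \<open>c\<close>.\<close>
  obtain \<sigma> :: int where \<sigma>: "\<sigma> = 1 \<or> \<sigma> = - 1" "\<And>i. \<sigma> * (ones w d i - int c) \<ge> 0"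
  proof (cases "\<exists>i. ones w d i > int c")
    case True
    then obtain i where i: "ones w d i > int c" by blast
    have "ones w d i \<le> ones w d j + 1" for j
      using bal unfolding balanced_def by blast
    with i have "ones w d j \<ge> int c" for j
      by (smt (verit, best))
    then show thesis using that[of 1] by simp
  next
    case False
    then show thesis using that[of "- 1"] by (simp add: not_less)
  qed
  define E where "E = {i. ones w d i \<noteq> int c}"
  show False
  proof (cases "finite E")
    case True
    then obtain b where "\<forall>i\<in>E. i < b"
      using finite_nat_set_iff_bounded by blast
    then have b: "ones w d i = int c" if "b \<le> i" for i
      using that unfolding E_def by (metis leD mem_Collect_eq)
    \<comment> \<open>A constant count means that the letter leaving the window equals the letter
      entering it.\<close>
    have "w (b + t) = w (b + d + t)" for t
    proof -
      have "ones w d (b + t) + of_bool (w (b + t + d)) = of_bool (w (b + t)) + ones w d (Suc (b + t))"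
        using ones_Suc[of w d "b + t"] ones_Suc_left[of w d "b + t"] by simp
      then have "of_bool (w (b + t + d)) = (of_bool (w (b + t)) :: int)"
        using b[of "b + t"] b[of "Suc (b + t)"] by simp
      then show ?thesis by (simp add: of_bool_eq_iff add.commute add.left_commute)
    qed
    then have "suffix_at w b = suffix_at w (b + d)"
      by (simp add: suffix_at_eq_iff)
    then show False using inj d by (auto dest: injD)
  next
    case False
    \<comment> \<open>Two members of \<open>E\<close> congruent modulo \<open>d\<close> start blocks
      of one tiling; their deviations have the same sign and add up to at least 2, against
      \<open>near\<close>.\<close>
    have "(\<lambda>i. i mod d) ` E \<subseteq> {..<d}" using d by auto
    then have "finite ((\<lambda>i. i mod d) ` E)" by (rule finite_subset) simp
    then obtain e where "e \<in> E" and "infinite {a \<in> E. a mod d = e mod d}"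
      using pigeonhole_infinite[OF False] by blast
    then obtain f where f: "f \<in> E" "f mod d = e mod d" "e < f"
      unfolding infinite_nat_iff_unbounded by blast
    then obtain k where k: "f = e + k * d"
      by (metis less_imp_le_nat mod_eq_nat1E mult.commute)
    have k0: "0 < k" using f k by (auto intro: gr0I)
    have "\<sigma> * (ones w (Suc k * d) e - int (Suc k) * int c) = (\<Sum>r<Suc k. \<sigma> * (ones w d (e + r * d) - int c))"
      unfolding ones_mult by (simp only: sum_distrib_left[symmetric] sum_subtractf sum_constant card_lessThan)
    also have "\<dots> \<ge> (\<Sum>r\<in>{0, k}. \<sigma> * (ones w d (e + r * d) - int c))"
      using \<sigma>(2) by (intro sum_mono2) auto
    also have "(\<Sum>r\<in>{0, k}. \<sigma> * (ones w d (e + r * d) - int c)) = \<sigma> * (ones w d e - int c) + \<sigma> * (ones w d f - int c)"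
      using k0 k by simp
    finally have "\<sigma> * (ones w (Suc k * d) e - int (Suc k) * int c) \<ge> \<sigma> * (ones w d e - int c) + \<sigma> * (ones w d f - int c)" .
    moreover have "\<sigma> * (ones w d e - int c) \<ge> 1" "\<sigma> * (ones w d f - int c) \<ge> 1"
      using \<sigma>(1) \<sigma>(2)[of e] \<sigma>(2)[of f] \<open>e \<in> E\<close> f(1) unfolding E_def by auto
    ultimately show False
      using near[of "Suc k" e] \<sigma>(1) by auto
  qed
qed


section \<open>Parsing the image of a Sturmian word\<close>

text \<open>
  For a concatenation of blocks of lengths \<open>h 0, h 1, \<dots>\<close>, the block containing position \<open>i\<close> and
  the offset of \<open>i\<close> inside that block.
\<close>

primrec block_pos :: "(nat \<Rightarrow> nat) \<Rightarrow> nat \<Rightarrow> nat \<times> nat" where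
  "block_pos h 0 = (0, 0)"
| "block_pos h (Suc i) =
    (let (m, q) = block_pos h i in if Suc q < h m then (m, Suc q) else (Suc m, 0))"

locale sturmian_marked_image =
  fixes s :: "nat \<Rightarrow> bool" and T :: "bool list \<Rightarrow> bool list"
  assumes sturmian: "sturmian s" and morphism: "morphism T" and marked: "marked T"
begin

abbreviation w :: "nat \<Rightarrow> bool" where
  "w \<equiv> morph_image T s"

definition blk :: "nat \<Rightarrow> nat" where
  "blk i = fst (block_pos (\<lambda>m. length (T [s m])) i)"

definition off :: "nat \<Rightarrow> nat" where
  "off i = snd (block_pos (\<lambda>m. length (T [s m])) i)"

text \<open>Forgetting the index of the block makes \<open>cell\<close> a word over a finite
  alphabet.\<close>

definition cell :: "nat \<Rightarrow> bool \<times> nat" where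
  "cell i = (s (blk i), off i)"

definition maxlen :: nat where
  "maxlen = max (length (T [False])) (length (T [True]))"

lemma T_append: "T (u @ v) = T u @ T v"
  using morphism by (simp add: morphism_def)

lemma T_nonempty: "T [a] \<noteq> []"
  using marked by (cases a) (auto simp: marked_def)

lemma length_T_pos: "0 < length (T [a])"
  using T_nonempty by blast

lemma length_T_le_maxlen: "length (T [a]) \<le> maxlen"
  by (cases a) (auto simp: maxlen_def)

lemma hd_T_eq_iff: "hd (T [a]) = hd (T [b]) \<longleftrightarrow> a = b"
  using marked by (cases a; cases b) (auto simp: marked_def)

lemma last_T_eq_iff: "last (T [a]) = last (T [b]) \<longleftrightarrow> a = b"
  using marked by (cases a; cases b) (auto simp: marked_def)

lemma inj_suffix_s: "inj (suffix_at s)"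
  using sturmian by (rule sturmian_inj_suffix_at)

lemma balanced_s: "balanced s"
  using sturmian by (rule sturmian_balanced)

lemma blk_off_Suc:
  "blk (Suc i) = (if Suc (off i) < length (T [s (blk i)]) then blk i else Suc (blk i))"
  "off (Suc i) = (if Suc (off i) < length (T [s (blk i)]) then Suc (off i) else 0)"
  by (auto simp: blk_def off_def Let_def split: prod.splits)

lemma off_less: "off i < length (T [s (blk i)])"
proof (induction i)
  case 0
  show ?case using length_T_pos by (simp add: off_def blk_def)
next
  case (Suc i)
  then show ?case using length_T_pos by (simp add: blk_off_Suc)
qed

lemma off_less_maxlen: "off i < maxlen"
  using off_less length_T_le_maxlen by (meson less_le_trans)

lemma blk_Suc: "blk (Suc i) = (if off (Suc i) = 0 then Suc (blk i) else blk i)"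
  by (simp add: blk_off_Suc)

lemma off_at_block_end: "off (Suc i) = 0 \<Longrightarrow> Suc (off i) = length (T [s (blk i)])"
  using off_less[of i] by (auto simp: blk_off_Suc split: if_splits)

lemma position_eq: "i = length (T (map s [0..<blk i])) + off i"
proof (induction i)
  case 0
  have "T [] = []" using T_append[of "[]" "[]"] by simp
  then show ?case by (simp add: blk_def off_def)
next
  case (Suc i)
  show ?case
  proof (cases "off (Suc i) = 0")
    case True
    then show ?thesis
      using Suc off_at_block_end[OF True] by (simp add: blk_Suc T_append)
  next
    case False
    then show ?thesis
      using Suc by (auto simp: blk_off_Suc split: if_splits)
  qed
qed

lemma w_eq: "w i = T [s (blk i)] ! off i"
proof -
  let ?P = "\<lambda>n. T (map s [0..<n])"
  have split: "?P (Suc (blk i)) = ?P (blk i) @ T [s (blk i)]"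
    by (simp add: T_append)
  have i: "i < length (?P (Suc (blk i)))"
    using position_eq[of i] off_less[of i] by (simp only: split length_append)
  have "w i = map w [0..<length (?P (Suc (blk i)))] ! i"
    using i by simp
  also have "\<dots> = ?P (Suc (blk i)) ! i"
    using morph_image_prefix[OF morphism T_nonempty, of s "Suc (blk i)"] by simp
  also have "\<dots> = T [s (blk i)] ! off i"
    unfolding split using position_eq[of i]
    by (metis nth_append_length_plus)
  finally show ?thesis .
qed

lemma w_cong: "cell x = cell y \<Longrightarrow> w x = w y"
  by (simp add: w_eq cell_def)

lemma cell_eq_iff: "cell x = cell y \<longleftrightarrow> s (blk x) = s (blk y) \<and> off x = off y"
  by (simp add: cell_def)

section \<open>Propagation of equal cells\<close>

lemma off_Suc_cong: "cell x = cell y \<Longrightarrow> off (Suc x) = off (Suc y)"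
  by (simp add: cell_def blk_off_Suc)

lemma cell_Suc_inside: "cell x = cell y \<Longrightarrow> off (Suc x) \<noteq> 0 \<Longrightarrow> cell (Suc x) = cell (Suc y)"
  using off_Suc_cong[of x y] by (simp add: cell_eq_iff blk_Suc)

lemma w_block_start: "off x = 0 \<Longrightarrow> w x = hd (T [s (blk x)])"
  by (simp add: w_eq hd_conv_nth T_nonempty)

lemma w_block_end:
  assumes "off (Suc x) = 0"
  shows "w x = last (T [s (blk x)])"
proof -
  have "off x = length (T [s (blk x)]) - 1"
    using off_at_block_end[OF assms] by simp
  then show ?thesis by (simp add: w_eq last_conv_nth T_nonempty)
qed

text \<open>Inside a block the next cell is forced; at a block start the letter of \<open>w\<close>
  is the first letter of the image and, by markedness, names the block.\<close>

lemma cell_Suc_cong: "cell x = cell y \<Longrightarrow> w (Suc x) = w (Suc y) \<Longrightarrow> cell (Suc x) = cell (Suc y)"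
  using cell_Suc_inside[of x y] off_Suc_cong[of x y]
  by (cases "off (Suc x) = 0") (auto simp: cell_eq_iff w_block_start hd_T_eq_iff)

lemma cell_eq_block_end:
  "off (Suc x) = 0 \<Longrightarrow> off (Suc y) = 0 \<Longrightarrow> w x = w y \<Longrightarrow> cell x = cell y"
  using off_at_block_end[of x] off_at_block_end[of y]
  by (auto simp: cell_eq_iff w_block_end last_T_eq_iff)

lemma cell_pred_inside: "cell (Suc x) = cell (Suc y) \<Longrightarrow> off (Suc x) \<noteq> 0 \<Longrightarrow> cell x = cell y"
  by (auto simp: cell_eq_iff blk_off_Suc split: if_splits)

text \<open>The leftward counterpart of \<open>cell_Suc_cong\<close>, resting on the distinct last
  letters of the images.\<close>

lemma cell_pred: "cell (Suc x) = cell (Suc y) \<Longrightarrow> w x = w y \<Longrightarrow> cell x = cell y"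
  using cell_pred_inside[of x y] cell_eq_block_end[of x y]
  by (cases "off (Suc x) = 0") (auto simp: cell_eq_iff)

text \<open>Equal cells cross block boundaries together, and \<open>e\<close> counts the crossings.
  The block reached at \<open>x + n\<close> stays outside \<open>f < e\<close>, since the cells
  there may differ.\<close>

lemma cell_synchronised:
  assumes "off x = off y" and "\<And>t. t < n \<Longrightarrow> cell (x + t) = cell (y + t)"
  obtains e where "blk (x + n) = blk x + e" "blk (y + n) = blk y + e" "off (x + n) = off (y + n)"
    "\<And>f. f < e \<Longrightarrow> s (blk x + f) = s (blk y + f)"
proof -
  have "\<exists>e. blk (x + n) = blk x + e \<and> blk (y + n) = blk y + e \<and> off (x + n) = off (y + n) \<and>
    (\<forall>f<e. s (blk x + f) = s (blk y + f))"
    using assms(2)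
  proof (induction n)
    case 0
    show ?case using assms(1) by simp
  next
    case (Suc n)
    then obtain e where e: "blk (x + n) = blk x + e" "blk (y + n) = blk y + e"
      "\<forall>f<e. s (blk x + f) = s (blk y + f)"
      by (metis less_Suc_eq)
    have eq: "cell (x + n) = cell (y + n)" using Suc.prems by simp
    then have off: "off (Suc (x + n)) = off (Suc (y + n))" by (rule off_Suc_cong)
    have "s (blk x + e) = s (blk y + e)" using eq e by (simp add: cell_eq_iff)
    then have "\<forall>f<Suc e. s (blk x + f) = s (blk y + f)"
      using e(3) by (simp add: less_Suc_eq)
    then show ?case
      using off e by (cases "off (Suc (x + n)) = 0") (auto simp: blk_Suc)
  qed
  then show thesis using that by blast
qed

text \<open>A potential that rises at every step because offsets stay below \<open>maxlen\<close>;
  it bounds from below the number of blocks crossed.\<close>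

lemma blk_off_growth: "blk x * maxlen + off x + n \<le> blk (x + n) * maxlen + off (x + n)"
proof (induction n)
  case (Suc n)
  have "blk (x + n) * maxlen + off (x + n) < blk (Suc (x + n)) * maxlen + off (Suc (x + n))"
  proof (cases "off (Suc (x + n)) = 0")
    case True
    then show ?thesis using off_less_maxlen[of "x + n"] by (simp add: blk_Suc)
  next
    case False
    then show ?thesis by (auto simp: blk_off_Suc split: if_splits)
  qed
  then show ?case using Suc by simp
qed simp

section \<open>Bounded periods and recognizability of the parse\<close>

lemma blk_add_bounds: "blk x \<le> blk (x + n)" "blk (x + n) \<le> blk x + n"
  by (induction n) (auto simp: blk_Suc)

text \<open>Period \<open>d\<close> of the cells near \<open>i\<close> gives \<open>s\<close> the
  period \<open>c\<close>, the number of blocks from \<open>i\<close> to \<open>i + d\<close>. It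
  depends on \<open>i\<close>, but \<open>0 < c\<close> and \<open>c \<le> d\<close>, so finitely
  many bounds for \<open>s\<close> suffice.\<close>

lemma cell_bounded_period:
  assumes d: "0 < d"
  shows "\<exists>K. \<forall>i. \<exists>t<K. cell (i + t) \<noteq> cell (i + d + t)"
proof -
  have "\<forall>c. \<exists>K. 0 < c \<longrightarrow> (\<forall>i. \<exists>t<K. s (i + t) \<noteq> s (i + c + t))"
    using balanced_aperiodic_bounded_period[OF balanced_s inj_suffix_s] by blast
  then obtain K where K: "\<And>c i. 0 < c \<Longrightarrow> \<exists>t<K c. s (i + t) \<noteq> s (i + c + t)"
    by metis
  define M where "M = Max (K ` {..d})"
  have M: "K c \<le> M" if "c \<le> d" for c
    using that by (simp add: M_def)
  have "\<exists>t<Suc M * maxlen. cell (i + t) \<noteq> cell (i + d + t)" for i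
  proof (rule ccontr)
    assume "\<not> ?thesis"
    then have eq: "\<And>t. t < Suc M * maxlen \<Longrightarrow> cell (i + t) = cell (i + d + t)" by blast
    have off: "off i = off (i + d)"
      using eq[of 0] off_less_maxlen[of i] by (simp add: cell_eq_iff)
    obtain e where e: "blk (i + Suc M * maxlen) = blk i + e"
      "\<And>f. f < e \<Longrightarrow> s (blk i + f) = s (blk (i + d) + f)"
      using cell_synchronised[OF off eq] by blast
    define N where "N = Suc M * maxlen"
    have "N < Suc e * maxlen"
      using blk_off_growth[of i N] off_less_maxlen[of "i + N"] e(1)[folded N_def]
      by (simp add: add_mult_distrib)
    then have Me: "M < e" unfolding N_def by simp
    obtain c where c: "blk (i + d) = blk i + c" "c \<le> d"
      using blk_add_bounds[of i d] by (metis add_le_cancel_left le_Suc_ex)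
    have "0 < c"
      using blk_off_growth[of i d] off c(1) d by (auto intro: gr0I)
    then obtain t where "t < K c" "s (blk i + t) \<noteq> s (blk i + c + t)"
      using K by blast
    then show False
      using e(2)[of t] M[OF c(2)] Me c(1) by simp
  qed
  then show ?thesis by blast
qed

text \<open>Different cells reading the same letter cannot both end a block. The one staying inside
  its block fixes the next letter, and with it the next cell of the other.\<close>

lemma cell_Suc_deterministic:
  assumes "cell a = cell a'" "cell b = cell b'" "cell a \<noteq> cell b" "w a = w b"
    "w (Suc a) = w (Suc b)" "w (Suc a') = w (Suc b')"
  shows "cell (Suc a) = cell (Suc a')"
proof (cases "off (Suc a) = 0")
  case True
  then have "off (Suc b) \<noteq> 0" using cell_eq_block_end assms by blast
  then have "w (Suc b) = w (Suc b')" using cell_Suc_inside assms w_cong by blast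
  then have "w (Suc a) = w (Suc a')" using assms(5,6) by simp
  then show ?thesis by (rule cell_Suc_cong[OF assms(1)])
qed (use cell_Suc_inside assms in blast)

text \<open>
  As long as two differently parsed factors agree, the markedness makes the pair of parses evolve
  deterministically in a finite state space; a long agreement is therefore periodic with a bounded
  period.
\<close>

lemma cell_recognizable:
  "\<exists>L. \<forall>x y. cell x \<noteq> cell y \<longrightarrow> (\<exists>r<L. w (x + r) \<noteq> w (y + r))"
proof -
  let ?A = "(UNIV \<times> {..<maxlen}) \<times> (UNIV \<times> {..<maxlen}) :: ((bool \<times> nat) \<times> (bool \<times> nat)) set"
  have "\<forall>d. \<exists>K. 0 < d \<longrightarrow> (\<forall>i. \<exists>t<K. cell (i + t) \<noteq> cell (i + d + t))"
    using cell_bounded_period by blast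
  then obtain K where K: "\<And>d i. 0 < d \<Longrightarrow> \<exists>t<K d. cell (i + t) \<noteq> cell (i + d + t)"
    by metis
  define S where "S = card ?A"
  define M where "M = Max (K ` {..S})"
  have M: "K d \<le> M" if "d \<le> S" for d
    using that by (simp add: M_def)
  \<comment> \<open>Among \<open>S + 1\<close> pairs of cells one repeats, at the latest at
    \<open>S\<close>; \<open>M\<close> further positions refute the resulting period, which is at
    most \<open>S\<close>.\<close>
  have "\<exists>r<S + M + 1. w (x + r) \<noteq> w (y + r)" if ne: "cell x \<noteq> cell y" for x y
  proof (rule ccontr)
    assume "\<not> ?thesis"
    then have w: "w (x + r) = w (y + r)" if "r < S + M + 1" for r using that by blast
    \<comment> \<open>By \<open>cell_pred\<close>, distinct parses cannot merge while the letters
      agree.\<close>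
    have ne': "cell (x + r) \<noteq> cell (y + r)" if "r < S + M + 1" for r
      using that
    proof (induction r)
      case (Suc r)
      then show ?case using cell_pred[of "x + r" "y + r"] w[of r] by auto
    qed (use ne in simp)
    define \<sigma> where "\<sigma> r = (cell (x + r), cell (y + r))" for r
    have "\<sigma> ` {..S} \<subseteq> ?A"
      using off_less_maxlen by (auto simp: \<sigma>_def cell_def)
    moreover have "finite ?A" by simp
    ultimately have "card (\<sigma> ` {..S}) \<le> S"
      unfolding S_def by (metis card_mono)
    then have "\<not> inj_on \<sigma> {..S}"
      by (intro pigeonhole) simp
    then obtain a b where ab: "a < b" "b \<le> S" "\<sigma> a = \<sigma> b"
      unfolding inj_on_def by (metis atMost_iff linorder_neqE_nat)
    have per: "\<sigma> (a + t) = \<sigma> (b + t)" if "b + t < S + M + 1" for t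
      using that
    proof (induction t)
      case (Suc t)
      then have eq: "cell (x + (a + t)) = cell (x + (b + t))" "cell (y + (a + t)) = cell (y + (b + t))"
        by (auto simp: \<sigma>_def)
      have "a + t < S + M + 1" "Suc (a + t) < S + M + 1" "Suc (b + t) < S + M + 1"
        using Suc.prems ab by auto
      note h = ne'[OF this(1)] w[OF this(1)] w[OF this(2)] w[OF this(3)]
      have "cell (Suc (x + (a + t))) = cell (Suc (x + (b + t)))"
        using cell_Suc_deterministic[OF eq] h by simp
      moreover have "cell (Suc (y + (a + t))) = cell (Suc (y + (b + t)))"
        using cell_Suc_deterministic[OF eq(2,1)] h by simp
      ultimately show ?case by (simp add: \<sigma>_def)
    qed (use ab in simp)
    obtain t where t: "t < K (b - a)" "cell (x + a + t) \<noteq> cell (x + a + (b - a) + t)"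
      using K[of "b - a" "x + a"] ab by auto
    have "b + t < S + M + 1"
      using t(1) M[of "b - a"] ab by linarith
    then show False
      using per[of t] t(2) ab by (simp add: \<sigma>_def add.assoc)
  qed
  then show ?thesis by blast
qed

section \<open>Comparing suffixes of the image\<close>

lemma inj_suffix_w: "inj (suffix_at w)"
proof (rule inj_suffix_atI)
  fix i d :: nat assume "0 < d"
  then obtain t where "cell (i + t) \<noteq> cell (i + d + t)"
    using cell_bounded_period by blast
  then obtain r where "w (i + t + r) \<noteq> w (i + d + t + r)"
    using cell_recognizable by blast
  then show "\<exists>t. w (i + t) \<noteq> w (i + d + t)"
    by (metis add.assoc)
qed

text \<open>Equal cells persist as long as the letters agree, so the first difference falls on the
  first letters of the images of two different letters of \<open>s\<close>. The first letter of
  \<open>T [False]\<close> tells whether the order is kept or reversed.\<close>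

lemma perm_less_same_cell:
  assumes cell: "cell x = cell y" and ne: "x \<noteq> y"
  shows "perm_less w x y \<longleftrightarrow> perm_less s (blk x) (blk y) = (\<not> hd (T [False]))"
proof -
  have "suffix_at w x \<noteq> suffix_at w y"
    using inj_suffix_w ne by (auto dest: injD)
  then obtain k where k: "\<And>t. t < k \<Longrightarrow> w (x + t) = w (y + t)" "w (x + k) \<noteq> w (y + k)"
    by (rule first_difference) blast
  have eq: "cell (x + t) = cell (y + t)" if "t < k" for t
    using that
  proof (induction t)
    case (Suc t)
    then show ?case using cell_Suc_cong[of "x + t" "y + t"] k(1)[of "Suc t"] by simp
  qed (use cell in simp)
  obtain e where e: "blk (x + k) = blk x + e" "blk (y + k) = blk y + e" "off (x + k) = off (y + k)"
    "\<And>f. f < e \<Longrightarrow> s (blk x + f) = s (blk y + f)"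
    using cell_synchronised[of x y k] cell eq by (auto simp: cell_eq_iff)
  have "k \<noteq> 0" using w_cong[OF cell] k(2) by (metis add.right_neutral)
  then obtain k' where k': "k = Suc k'" by (cases k) auto
  have off: "off (x + k) = 0"
    using cell_Suc_inside[of "x + k'" "y + k'"] eq[of k'] k(2) w_cong[of "x + k" "y + k"] k' by auto
  have wk: "w (x + k) = hd (T [s (blk x + e)])" "w (y + k) = hd (T [s (blk y + e)])"
    using w_block_start[of "x + k"] w_block_start[of "y + k"] off e by auto
  have se: "s (blk x + e) \<noteq> s (blk y + e)"
  proof
    assume "s (blk x + e) = s (blk y + e)"
    then show False using wk k(2) by (simp only:)
  qed
  define h where "h = hd (T [False])"
  have "hd (T [a]) = (a \<noteq> h)" for a
    using hd_T_eq_iff[of True False] by (cases a) (auto simp: h_def)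
  then have "w (x + k) = (s (blk x + e) \<noteq> h)" "w (y + k) = (s (blk y + e) \<noteq> h)"
    using wk by simp_all
  then show ?thesis
    using perm_less_iff[of k w x y, OF k] perm_less_iff[of e s "blk x" "blk y", OF e(4) se] se
    unfolding h_def[symmetric] by auto
qed

text \<open>Suffixes with distinct cells differ within \<open>L\<close> letters, which the
  \<open>L\<close> extra cells reveal. For equal cells the comparison moves to \<open>s\<close>,
  where the letters of the blocks between the two positions decide.\<close>

lemma perm_less_cell_cong:
  "\<exists>L. \<forall>n i j. window cell (n + L) i = window cell (n + L) j \<longrightarrow>
    (\<forall>a b. a < b \<and> b < n \<longrightarrow> perm_less w (i + a) (i + b) = perm_less w (j + a) (j + b))"
proof -
  obtain L where L: "\<And>x y. cell x \<noteq> cell y \<Longrightarrow> \<exists>r<L. w (x + r) \<noteq> w (y + r)"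
    using cell_recognizable by blast
  have "perm_less w (i + a) (i + b) = perm_less w (j + a) (j + b)"
    if win: "window cell (n + L) i = window cell (n + L) j" and ab: "a < b" "b < n" for n i j a b
  proof -
    have eq: "cell (i + t) = cell (j + t)" if "t < n + L" for t
      using win that by (simp add: window_eq_iff)
    show ?thesis
    proof (cases "cell (i + a) = cell (i + b)")
      case True
      then have True': "cell (j + a) = cell (j + b)"
        using eq[of a] eq[of b] ab by simp
      have off: "off (i + a) = off (j + a)"
        using eq[of a] ab by (simp add: cell_eq_iff)
      have "cell (i + a + t) = cell (j + a + t)" if "t < b - a" for t
        using eq[of "a + t"] ab that by (simp add: add.assoc)
      then obtain e where e: "blk (i + a + (b - a)) = blk (i + a) + e"
        "blk (j + a + (b - a)) = blk (j + a) + e"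
        "\<And>f. f < e \<Longrightarrow> s (blk (i + a) + f) = s (blk (j + a) + f)"
        using cell_synchronised[OF off] by metis
      have "blk (i + b) = blk (i + a) + e" "blk (j + b) = blk (j + a) + e"
        using e(1,2) ab by auto
      moreover have "perm_less s (blk (i + a)) (blk (i + a) + e) = perm_less s (blk (j + a)) (blk (j + a) + e)"
        by (rule balanced_perm_less_cong[OF balanced_s inj_suffix_s e(3)])
      ultimately show ?thesis
        using perm_less_same_cell[OF True] perm_less_same_cell[OF True'] ab by simp
    next
      case False
      then obtain r where r: "r < L" "w (i + a + r) \<noteq> w (i + b + r)"
        using L by blast
      have "suffix_at w (i + a) \<noteq> suffix_at w (i + b)"
        using inj_suffix_w ab by (auto dest: injD)
      then obtain k where k: "\<And>t. t < k \<Longrightarrow> w (i + a + t) = w (i + b + t)" "w (i + a + k) \<noteq> w (i + b + k)"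
        by (rule first_difference) blast
      have "k \<le> r" using k(1)[of r] r by (meson not_le)
      then have w: "w (i + a + t) = w (j + a + t)" "w (i + b + t) = w (j + b + t)" if "t \<le> k" for t
        using w_cong[OF eq[of "a + t"]] w_cong[OF eq[of "b + t"]] that r ab by (auto simp: add.assoc)
      show ?thesis
        using perm_less_iff[of k w "i + a" "i + b", OF k] perm_less_iff[of k w "j + a" "j + b"] k w
        by simp
    qed
  qed
  then show ?thesis by blast
qed

section \<open>Factor complexity of the cell word\<close>

lemma finite_factors_cell: "finite (factors cell n)"
proof (rule finite_subset)
  show "factors cell n \<subseteq> {xs. set xs \<subseteq> UNIV \<times> {..<maxlen} \<and> length xs = n}"
    using off_less_maxlen by (auto simp: factors_def cell_def)
  show "finite {xs :: (bool \<times> nat) list. set xs \<subseteq> UNIV \<times> {..<maxlen} \<and> length xs = n}"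
    by (rule finite_lists_length_eq) simp
qed

lemma cell_branching:
  assumes n: "0 < n" and win: "window cell n x = window cell n y" and ne: "cell (x + n) \<noteq> cell (y + n)"
  shows "off (x + n) = 0" and "off (y + n) = 0"
proof -
  obtain n' where n': "n = Suc n'" using n by (cases n) auto
  have eq: "cell (x + n') = cell (y + n')"
    using win n' by (simp add: window_eq_iff)
  show "off (x + n) = 0"
    using cell_Suc_inside[OF eq] ne n' by auto
  then show "off (y + n) = 0"
    using off_Suc_cong[OF eq] n' by simp
qed

text \<open>Both occurrences pass the same \<open>e\<close> letters of \<open>s\<close> from offset
  \<open>t\<close> on, with equal offsets at the end; differing cells there mean differing letters
  of \<open>s\<close>.\<close>

lemma cell_branching_right_special:
  assumes "window cell n x = window cell n y" and "cell (x + n) \<noteq> cell (y + n)" and "t < n"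
    and e: "blk (x + n) = blk (x + t) + e"
  shows "right_special s e (blk (x + t))"
proof -
  have eq: "cell (x + r) = cell (y + r)" if "r < n" for r
    using assms(1) that by (simp add: window_eq_iff)
  have off: "off (x + t) = off (y + t)"
    using eq[OF assms(3)] by (simp add: cell_eq_iff)
  have "cell (x + t + r) = cell (y + t + r)" if "r < n - t" for r
    using eq[of "t + r"] that by (simp add: add.assoc)
  then obtain e' where e': "blk (x + t + (n - t)) = blk (x + t) + e'"
    "blk (y + t + (n - t)) = blk (y + t) + e'" "off (x + t + (n - t)) = off (y + t + (n - t))"
    "\<And>f. f < e' \<Longrightarrow> s (blk (x + t) + f) = s (blk (y + t) + f)"
    using cell_synchronised[OF off] by metis
  have "e' = e" using e e'(1) assms(3) by simp
  then have "window s e (blk (y + t)) = window s e (blk (x + t))"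
    using e'(4) by (simp add: window_eq_iff)
  moreover have "s (blk (y + t) + e) \<noteq> s (blk (x + t) + e)"
    using e' \<open>e' = e\<close> assms(2,3) by (auto simp: cell_eq_iff)
  ultimately show ?thesis
    unfolding right_special_def by blast
qed

text \<open>Going backwards from the branching, cells inside a block are forced. At a block
  boundary, the blocks from there to the branching spell right special factors of \<open>s\<close>
  of the same length, which coincide.\<close>

lemma cell_right_special_unique:
  assumes x: "window cell n x = window cell n y" "cell (x + n) \<noteq> cell (y + n)"
    and x': "window cell n x' = window cell n y'" "cell (x' + n) \<noteq> cell (y' + n)"
    and eq: "cell (x + n) = cell (x' + n)"
  shows "window cell n x = window cell n x'"
proof -
  have "\<forall>t. n - k \<le> t \<and> t \<le> n \<longrightarrow> cell (x + t) = cell (x' + t)" if "k \<le> n" for k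
    using that
  proof (induction k)
    case 0
    then show ?case using eq by auto
  next
    case (Suc k)
    define u where "u = n - Suc k"
    have u: "u < n" "Suc u = n - k" using Suc.prems by (auto simp: u_def)
    have IH: "cell (x + t) = cell (x' + t)" if "u < t" "t \<le> n" for t
      using Suc that u by auto
    have su: "cell (Suc (x + u)) = cell (Suc (x' + u))"
      using IH[of "Suc u"] u(1) by simp
    have "cell (x + u) = cell (x' + u)"
    proof (cases "off (Suc (x + u)) = 0")
      case False
      then show ?thesis using cell_pred_inside su by blast
    next
      case True
      have True': "off (Suc (x' + u)) = 0" using True su by (simp add: cell_eq_iff)
      have "off (Suc (x + u)) = off (Suc (x' + u))" using True True' by simp
      moreover have "cell (Suc (x + u) + r) = cell (Suc (x' + u) + r)" if "r < n - Suc u" for r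
        using IH[of "Suc (u + r)"] that u by (simp add: add.assoc)
      ultimately obtain g where g: "blk (Suc (x + u) + (n - Suc u)) = blk (Suc (x + u)) + g"
        "blk (Suc (x' + u) + (n - Suc u)) = blk (Suc (x' + u)) + g"
        using cell_synchronised by metis
      then have "blk (x + n) = blk (x + u) + Suc g" "blk (x' + n) = blk (x' + u) + Suc g"
      proof -
        have "Suc (x + u) + (n - Suc u) = x + n" "Suc (x' + u) + (n - Suc u) = x' + n"
          using u(1) by auto
        then show "blk (x + n) = blk (x + u) + Suc g" "blk (x' + n) = blk (x' + u) + Suc g"
          using g blk_Suc[of "x + u"] blk_Suc[of "x' + u"] True True' by simp_all
      qed
      then have "right_special s (Suc g) (blk (x + u))" "right_special s (Suc g) (blk (x' + u))"
        using cell_branching_right_special[OF x u(1)] cell_branching_right_special[OF x' u(1)] by auto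
      then have "window s (Suc g) (blk (x + u)) = window s (Suc g) (blk (x' + u))"
        by (rule sturmian_right_special_unique[OF sturmian])
      then have "s (blk (x + u)) = s (blk (x' + u))"
        by (simp add: window_Suc_left)
      then show ?thesis
        using off_at_block_end[OF True] off_at_block_end[OF True'] by (simp add: cell_eq_iff)
    qed
    then have "cell (x + t) = cell (x' + t)" if "u \<le> t" "t \<le> n" for t
      using IH that by (cases "t = u") auto
    then show ?case unfolding u_def by blast
  qed
  from this[of n] show ?thesis by (simp add: window_eq_iff)
qed

lemma card_factors_cell_Suc:
  assumes n: "0 < n"
  shows "card (factors cell (Suc n)) \<le> Suc (card (factors cell n))"
proof -
  \<comment> \<open>Branching extensions that start a block of letter 1. There is at most one, and
    removing it makes \<open>butlast\<close> injective, since of two extensions of the same factor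
    exactly one starts such a block.\<close>
  define R where "R = {window cell (Suc n) x | x y.
    window cell n x = window cell n y \<and> cell (x + n) \<noteq> cell (y + n) \<and> s (blk (x + n))}"
  have R: "u = v" if u: "u \<in> R" and v: "v \<in> R" for u v
  proof -
    obtain x y where x: "u = window cell (Suc n) x" "window cell n x = window cell n y"
      "cell (x + n) \<noteq> cell (y + n)" "s (blk (x + n))"
      using u unfolding R_def by blast
    obtain x' y' where x': "v = window cell (Suc n) x'" "window cell n x' = window cell n y'"
      "cell (x' + n) \<noteq> cell (y' + n)" "s (blk (x' + n))"
      using v unfolding R_def by blast
    have "cell (x + n) = cell (x' + n)"
      using cell_branching(1)[OF n x(2,3)] cell_branching(1)[OF n x'(2,3)] x(4) x'(4)
      by (simp add: cell_eq_iff)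
    then show ?thesis
      using cell_right_special_unique[OF x(2,3) x'(2,3)] x(1) x'(1) by (simp add: window_Suc)
  qed
  have finR: "finite R"
    by (rule finite_subset[OF _ finite_factors_cell[of "Suc n"]]) (auto simp: R_def factors_eq_range)
  have cardR: "card R \<le> 1"
    using R finR by (auto simp: card_le_Suc0_iff_eq)
  have "inj_on butlast (factors cell (Suc n) - R)"
  proof (rule inj_onI)
    fix u v assume u: "u \<in> factors cell (Suc n) - R" and v: "v \<in> factors cell (Suc n) - R"
      and eq: "butlast u = butlast v"
    obtain x where x: "u = window cell (Suc n) x" using u by (auto simp: factors_eq_range)
    obtain y where y: "v = window cell (Suc n) y" using v by (auto simp: factors_eq_range)
    have win: "window cell n x = window cell n y" using eq x y by (simp add: window_Suc)
    show "u = v"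
    proof (rule ccontr)
      assume "u \<noteq> v"
      then have ne: "cell (x + n) \<noteq> cell (y + n)" using x y win by (simp add: window_Suc)
      then have "s (blk (x + n)) \<noteq> s (blk (y + n))"
        using cell_branching[OF n win ne] by (simp add: cell_eq_iff)
      then have "s (blk (x + n)) \<or> s (blk (y + n))" by blast
      then have "u \<in> R \<or> v \<in> R"
        unfolding R_def x y using win win[symmetric] ne ne[symmetric] by blast
      then show False using u v by blast
    qed
  qed
  moreover have "butlast ` (factors cell (Suc n) - R) \<subseteq> factors cell n"
    by (auto simp: factors_eq_range window_Suc)
  ultimately have "card (factors cell (Suc n) - R) \<le> card (factors cell n)"
    using finite_factors_cell by (intro card_inj_on_le) auto
  moreover have "card (factors cell (Suc n)) \<le> card (factors cell (Suc n) - R) + card R"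
    by (metis diff_card_le_card_Diff finR le_diff_conv)
  ultimately show ?thesis using cardR by linarith
qed

lemma card_factors_cell: "card (factors cell (Suc n)) \<le> card (factors cell 1) + n"
proof (induction n)
  case (Suc n)
  then show ?case using card_factors_cell_Suc[of "Suc n"] by simp
qed simp

end


section \<open>Permutation complexity\<close>

text \<open>Equality of the subpermutations of length \<open>n\<close> at \<open>i\<close> and
  \<open>j\<close>, expressed without permutations; \<open>subperm_eq_iff\<close> links the
  two.\<close>

definition order_cong :: "(nat \<Rightarrow> 'a::linorder) \<Rightarrow> nat \<Rightarrow> nat \<Rightarrow> nat \<Rightarrow> bool" where
  "order_cong w n i j \<longleftrightarrow>
    (\<forall>a b. a < n \<and> b < n \<longrightarrow> perm_less w (i + a) (i + b) = perm_less w (j + a) (j + b))"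

lemma perm_less_not_sym:
  assumes "inj (suffix_at w)" "i \<noteq> j"
  shows "perm_less w i j \<longleftrightarrow> \<not> perm_less w j i"
proof -
  have "suffix_at w i \<noteq> suffix_at w j" using assms by (auto dest: injD)
  then show ?thesis
    using perm_less_total perm_less_trans perm_less_irrefl by metis
qed

lemma order_congI:
  assumes "inj (suffix_at w)"
    and "\<And>a b. a < b \<Longrightarrow> b < n \<Longrightarrow> perm_less w (i + a) (i + b) = perm_less w (j + a) (j + b)"
  shows "order_cong w n i j"
  unfolding order_cong_def
proof (intro allI impI)
  fix a b assume "a < n \<and> b < n"
  then show "perm_less w (i + a) (i + b) = perm_less w (j + a) (j + b)"
    using assms(2)[of a b] assms(2)[of b a]
      perm_less_not_sym[OF assms(1), of "i + a" "i + b"] perm_less_not_sym[OF assms(1), of "j + a" "j + b"]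
    by (cases a b rule: linorder_cases) (auto simp: perm_less_irrefl)
qed

lemma subperm_eq_iff:
  fixes w :: "nat \<Rightarrow> 'a::linorder"
  assumes inj: "inj (suffix_at w)"
  shows "subperm w i (i + n) = subperm w j (j + n) \<longleftrightarrow> order_cong w (Suc n) i j"
proof
  assume cong: "order_cong w (Suc n) i j"
  have "perm_less w (i + k - 1) (i + m - 1) = perm_less w (j + k - 1) (j + m - 1)"
    if "k \<in> {1..n + 1}" "m \<in> {1..n + 1}" for k m
  proof -
    have "k - 1 < Suc n" "m - 1 < Suc n" using that by auto
    then have "perm_less w (i + (k - 1)) (i + (m - 1)) = perm_less w (j + (k - 1)) (j + (m - 1))"
      using cong unfolding order_cong_def by blast
    then show ?thesis using that by simp
  qed
  then show "subperm w i (i + n) = subperm w j (j + n)"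
    unfolding subperm_def diff_add_inverse
    by (intro arg_cong[of _ _ The] ext conj_cong refl ball_cong) (simp only:)
next
  assume eq: "subperm w i (i + n) = subperm w j (j + n)"
  have spec: "subperm w i (i + n) k < subperm w i (i + n) m \<longleftrightarrow> perm_less w (i + k - 1) (i + m - 1)"
    if "k \<in> {1..n + 1}" "m \<in> {1..n + 1}" for i k m
    using theI'[OF subperm_ex1[OF inj, of "n + 1" i]] that by (simp add: subperm_def)
  show "order_cong w (Suc n) i j"
    unfolding order_cong_def
  proof (intro allI impI)
    fix a b assume "a < Suc n \<and> b < Suc n"
    then show "perm_less w (i + a) (i + b) = perm_less w (j + a) (j + b)"
      using spec[of "Suc a" "Suc b" i] spec[of "Suc a" "Suc b" j] eq by simp
  qed
qed

lemma perm_complexity_Suc_eq: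
  assumes "0 < n"
  shows "perm_complexity w (Suc n) = card (range (\<lambda>i. subperm w i (i + n)))"
proof -
  have "{subperm w i j | i j. i < j \<and> j - i + 1 = Suc n} = range (\<lambda>i. subperm w i (i + n))"
  proof (intro equalityI subsetI)
    fix p assume "p \<in> {subperm w i j | i j. i < j \<and> j - i + 1 = Suc n}"
    then obtain i j where "p = subperm w i j" "i < j" "j - i + 1 = Suc n" by blast
    moreover from this have "j = i + n" by simp
    ultimately show "p \<in> range (\<lambda>i. subperm w i (i + n))" by blast
  next
    fix p assume "p \<in> range (\<lambda>i. subperm w i (i + n))"
    then obtain i where "p = subperm w i (i + n)" by blast
    moreover have "i < i + n" "i + n - i + 1 = Suc n" using assms by auto
    ultimately show "p \<in> {subperm w i j | i j. i < j \<and> j - i + 1 = Suc n}" by blast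
  qed
  then show ?thesis by (simp add: perm_complexity_def)
qed

text \<open>The suffixes at \<open>i\<close> and \<open>Suc i\<close> first differ where the run of
  equal letters starting at \<open>i\<close> ends: a run of ones is followed by a zero, a run of
  zeros by a one.\<close>

lemma letter_iff_perm_less:
  fixes w :: "nat \<Rightarrow> bool"
  assumes "inj (suffix_at w)"
  shows "w i \<longleftrightarrow> \<not> perm_less w i (Suc i)"
proof -
  have "suffix_at w i \<noteq> suffix_at w (Suc i)" using assms by (auto dest: injD)
  then obtain k where k: "\<And>t. t < k \<Longrightarrow> w (i + t) = w (Suc i + t)" "w (i + k) \<noteq> w (Suc i + k)"
    by (rule first_difference) blast
  have "w (i + t) = w i" if "t \<le> k" for t
    using that
  proof (induction t)
    case (Suc t)
    then show ?case using k(1)[of t] by simp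
  qed simp
  then show ?thesis using perm_less_iff[OF k] k(2) by auto
qed

section \<open>Growth of the permutation complexity\<close>

lemma finite_subperms:
  assumes "inj (suffix_at w)"
  shows "finite (range (\<lambda>i. subperm w i (i + n)))"
proof (rule finite_subset)
  show "range (\<lambda>i. subperm w i (i + n)) \<subseteq> {p. p permutes {1..n + 1}}"
    using theI'[OF subperm_ex1[OF assms, of "n + 1"]] by (auto simp: subperm_def)
  show "finite {p. p permutes {1..n + 1}}"
    by (rule finite_permutations) simp
qed

lemma perm_complexity_strict:
  fixes w :: "nat \<Rightarrow> bool"
  assumes inj: "inj (suffix_at w)" and n: "0 < n"
  shows "perm_complexity w (Suc n) < perm_complexity w (Suc (Suc n))"
proof (rule ccontr)
  let ?p = "\<lambda>n i. subperm w i (i + n)"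
  assume "\<not> ?thesis"
  then have le: "card (range (?p (Suc n))) \<le> card (range (?p n))"
    using n perm_complexity_Suc_eq[of n w] perm_complexity_Suc_eq[of "Suc n" w] by simp
  have restrict: "?p n i = ?p n j" if "?p (Suc n) i = ?p (Suc n) j" for i j
    using that unfolding subperm_eq_iff[OF inj] order_cong_def by (meson less_SucI)
  \<comment> \<open>The map cutting off the last entry, well defined by \<open>restrict\<close> and
    onto; if the count does not grow, it is injective.\<close>
  define g where "g q = ?p n (SOME i. ?p (Suc n) i = q)" for q
  have g: "g (?p (Suc n) i) = ?p n i" for i
    unfolding g_def by (rule restrict) (rule someI, rule refl)
  have "range (?p n) = g ` range (?p (Suc n))"
    by (simp only: image_image g)
  then have "card (g ` range (?p (Suc n))) = card (range (?p (Suc n)))"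
    using le card_image_le[OF finite_subperms[OF inj, of "Suc n"], of g] by simp
  then have inj_g: "inj_on g (range (?p (Suc n)))"
    by (rule eq_card_imp_inj_on[OF finite_subperms[OF inj]])
  have extend: "?p (Suc n) i = ?p (Suc n) j" if "?p n i = ?p n j" for i j
  proof (rule inj_onD[OF inj_g])
    show "g (?p (Suc n) i) = g (?p (Suc n) j)" unfolding g by (rule that)
  qed (rule rangeI)+
  have step: "?p n (Suc i) = ?p n (Suc j)" if "?p n i = ?p n j" for i j
  proof -
    have "order_cong w (Suc (Suc n)) i j"
      using extend[OF that] unfolding subperm_eq_iff[OF inj] .
    then have "perm_less w (i + Suc a) (i + Suc b) = perm_less w (j + Suc a) (j + Suc b)"
      if "a < Suc n" "b < Suc n" for a b
      using that unfolding order_cong_def by blast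
    then show ?thesis
      unfolding subperm_eq_iff[OF inj] order_cong_def by simp
  qed
  have "i = j" if eq: "?p n i = ?p n j" for i j
  proof -
    have all: "?p n (i + t) = ?p n (j + t)" for t
    proof (induction t)
      case (Suc t)
      show ?case using step[OF Suc] by simp
    qed (simp add: eq)
    have "w (i + t) = w (j + t)" for t
    proof -
      have "order_cong w (Suc n) (i + t) (j + t)"
        using all[of t] subperm_eq_iff[OF inj] by blast
      \<comment> \<open>Since \<open>0 < n\<close>, the compared range contains both 0 and 1, whose
        order encodes the letter.\<close>
      then have "perm_less w (i + t + 0) (i + t + 1) = perm_less w (j + t + 0) (j + t + 1)"
        using n unfolding order_cong_def by (auto dest: spec2[of _ 0 1])
      then show ?thesis using letter_iff_perm_less[OF inj] by simp
    qed
    then show "i = j"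
      using inj by (auto simp: inj_def suffix_at_eq_iff)
  qed
  then have "inj (?p n)" by (rule injI)
  then show False
    using finite_subperms[OF inj, of n] finite_imageD infinite_UNIV_nat by blast
qed

lemma (in sturmian_marked_image) perm_complexity_le:
  "\<exists>C. \<forall>n>0. perm_complexity w (Suc n) \<le> n + C"
proof -
  obtain L where L: "\<And>n i j a b. window cell (n + L) i = window cell (n + L) j \<Longrightarrow> a < b \<Longrightarrow> b < n \<Longrightarrow>
      perm_less w (i + a) (i + b) = perm_less w (j + a) (j + b)"
    using perm_less_cell_cong by blast
  have "perm_complexity w (Suc n) \<le> n + (L + card (factors cell 1))" if "0 < n" for n
  proof -
    let ?W = "window cell (Suc n + L)" and ?p = "\<lambda>i. subperm w i (i + n)"
    have cong: "?p i = ?p j" if "?W i = ?W j" for i j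
      unfolding subperm_eq_iff[OF inj_suffix_w] by (rule order_congI[OF inj_suffix_w L[OF that]])
    define g where "g u = ?p (SOME i. ?W i = u)" for u
    have "g (?W i) = ?p i" for i
      unfolding g_def by (rule cong) (rule someI, rule refl)
    then have "range ?p = g ` factors cell (Suc n + L)"
      by (simp add: factors_eq_range image_image)
    then have "card (range ?p) \<le> card (factors cell (Suc n + L))"
      using card_image_le[OF finite_factors_cell] by simp
    also have "\<dots> \<le> card (factors cell 1) + (n + L)"
      using card_factors_cell[of "n + L"] by simp
    finally show ?thesis
      using perm_complexity_Suc_eq[OF that, of w] by simp
  qed
  then show ?thesis by blast
qed

lemma strict_mono_bounded_eventually_linear:
  fixes f :: "nat \<Rightarrow> nat"
  assumes mono: "\<And>n. M \<le> n \<Longrightarrow> f n < f (Suc n)" and le: "\<And>n. M \<le> n \<Longrightarrow> f n \<le> n + C"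
  shows "\<exists>N (k::int). \<forall>n>N. int (f n) = int n + k"
proof -
  \<comment> \<open>The slack below the bound, exact despite truncated subtraction once
    \<open>M \<le> n\<close>. It never increases from \<open>M\<close> on, so it stays at its
    minimum once attained.\<close>
  define g where "g n = n + C - f n" for n
  obtain N where N: "M \<le> N" and least: "\<And>n. M \<le> n \<Longrightarrow> g N \<le> g n"
    using ex_has_least_nat[of "\<lambda>n. M \<le> n" M g, OF order.refl] by blast
  have const: "g n = g N" if "N \<le> n" for n
    using that
  proof (induction n rule: dec_induct)
    case (step n)
    have "g (Suc n) \<le> g n"
      using mono[of n] N step by (simp add: g_def)
    then show ?case using least[of "Suc n"] N step by simp
  qed simp
  have "int (f n) = int n + (int C - int (g N))" if "N < n" for n
  proof -
    have "f n + g n = n + C"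
      using le[of n] N that by (simp add: g_def)
    moreover have "g n = g N"
      using that by (intro const) simp
    ultimately show ?thesis by linarith
  qed
  then show ?thesis by blast
qed

theorem theorem6:
  fixes s :: "nat \<Rightarrow> bool" and T :: "bool list \<Rightarrow> bool list"
  assumes "sturmian s" and "morphism T" and "marked T"
  shows "\<exists>(N::nat) (k::int). \<forall>n>N. int (perm_complexity (morph_image T s) n) = int n + k"
proof -
  interpret sturmian_marked_image s T
    by unfold_locales (rule assms)+
  obtain C where C: "\<And>n. 0 < n \<Longrightarrow> perm_complexity w (Suc n) \<le> n + C"
    using perm_complexity_le by blast
  \<comment> \<open>The growth and the upper bound concern lengths \<open>Suc n'\<close> with
    \<open>0 < n'\<close>, hence the start at 2.\<close>
  show ?thesis
  proof (rule strict_mono_bounded_eventually_linear[where M = 2 and C = C])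
    fix n :: nat assume n: "2 \<le> n"
    then obtain n' where n': "n = Suc n'" "0 < n'" by (cases n) auto
    show "perm_complexity w n < perm_complexity w (Suc n)"
      unfolding n'(1) by (rule perm_complexity_strict[OF inj_suffix_w n'(2)])
    show "perm_complexity w n \<le> n + C"
      using C[OF n'(2)] n'(1) by simp
  qed
qed

end
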